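(* Let $k$ be a field, let $R=k[x_1,\ldots,x_n]/I$ with $I=(q_1,\ldots,q_m)$, where each $q_l$ is a quadratic monomial $x_ix_j$ with $i,j\in\{1,\ldots,n\}$ not necessarily different. Let $i$ be an index such that $x_i$ is a factor of some $q_l$. Then the sequence of free $R$-modules and maps $$\cdots \to M_3\to M_2\to M_1\to M_0\to 0$$ obtained by applying the Chain Complex Construction Procedure to $R$ with initial map $R\xrightarrow{x_i}R$ is a chain complex of free $R$-modules, i.e. the composition of any two consecutive maps is zero.
   Context: **Chain Complex Construction Procedure.** Let $k$ be a field and $R=k[x_1,\ldots,x_n]/I$, with $I$ generated by quadratic monomials $q_1,\ldots,q_m$ (each $q_l=x_ix_j$, $i=j$ allowed). The procedure builds a graded diagram: a set of vertices in each degree $d\ge 0$, together with arrows from vertices of degree $d+1$ to vertices of degree $d$. Each arrow carries a label $i\in\{1,\ldots,n\}$ and a sign $+$ or $-$ (no sign written means $+$). *Initial map.* Choose $i$ such that $x_i$ is a factor of some $q_l$. There is one vertex in degree $0$, one vertex in degree $1$, and one arrow from the latter to the former, with label $i$ and sign $+$. *Completion.* Given the vertices of degrees $d$ and $d+1$ and the arrows between them ($d\ge 0$), the vertices of degree $d+2$ and the arrows from degree $d+2$ to degree $d+1$ are exactly those produced by the following rules. (a) Column completion: for every arrow $v\to w$ from degree $d+1$ to degree $d$ with label $i$ (of either sign), and every $j\in\{1,\ldots,n\}$ ($j=i$ allowed) with $x_ix_j\in I$, add a new vertex $u$ of degree $d+2$ and an arrow $u\to v$ with label $j$. (b) Diamond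 completion: for every two arrows $v\to w$ with label $i$ and $v'\to w$ with label $j$ (of either sign) from two different vertices $v,v'$ of degree $d+1$ to the same vertex $w$ of degree $d$, with $i\ne j$ and $x_ix_j\notin I$, add a new vertex $u$ of degree $d+2$ with an arrow $u\to v$ of label $j$ and an arrow $u\to v'$ of label $i$. (c) No repetitions: whenever two or more of the arrows added by (a) and (b) have the same target vertex and the same label, they are merged, i.e. identified into a single arrow (and hence their source vertices are identified as well). This applies to two columns, to a column and a diamond, and to two diamonds. *Signs.* In each diamond completed in (b) (also after merging), one of its four arrows $u\to v$, $u\to v'$, $v\to w$, $v'\to w$ must have a sign different from the other three. The convention is that, if $v\to w$ and $v'\to w$ have sign $+$, the top arrow with the smaller label carries the minus sign, but the sign may be placed on another arrow; if one of the arrows $v\to w$, $v'\to w$ already carries a minus sign, that sign is kept and the diamond is completed with arrows of sign $+$. Arrows arising only from column completions have sign $+$. The completion step is repeated for $d=0,1,2,\ldots$ indefinitely. *From the diagram to modules.* $M_d$ is the free $R$-module with basis the set of vertices of degree $d$ (and $M_d=0$ for $d<0$). The map $M_{d+1}\to M_d$ is the one whose component from the copy of $R$ at $v$ to the copy of $R$ at $w$ is multiplication by the sum of $\pm x_i$ over all arrows $v\to w$, where $i$ is the label and $\pm$ the sign of the arrow (zero if there is no arrow). *)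

theory Defs
  imports
    "HOL-Library.Poly_Mapping"
    "HOL-Library.FSet"
    "HOL-Library.FuncSet"
    "HOL-Algebra.QuotRing"
    "HOL-Algebra.Module"
begin

section \<open>Quotients of polynomial rings\<close>

text \<open>Polynomials over \<open>'k\<close> in the variables indexed by the finite type \<open>'n\<close>.\<close>

type_synonym ('n, 'k) mpolynomial = "('n \<Rightarrow>\<^sub>0 nat) \<Rightarrow>\<^sub>0 'k"

definition X :: "'n \<Rightarrow> ('n, 'k::field) mpolynomial" where
  "X i = Poly_Mapping.single (Poly_Mapping.single i 1) 1"

definition poly_ring :: "('n, 'k::field) mpolynomial ring" where
  "poly_ring = \<lparr>carrier = UNIV, mult = (*), one = 1, zero = 0, add = (+)\<rparr>"

definition quot_ring :: "('n, 'k::field) mpolynomial set \<Rightarrow> ('n, 'k) mpolynomial set ring" where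
  "quot_ring I = poly_ring Quot I"

definition xbar :: "('n, 'k::field) mpolynomial set \<Rightarrow> 'n \<Rightarrow> ('n, 'k) mpolynomial set" where
  "xbar I i = I +>\<^bsub>poly_ring\<^esub> X i"

section \<open>The diagram\<close>

text \<open>
  Two distinct arrows with the same target and the same label never survive the merging, and every
  vertex of positive degree is the source of some arrow. Hence a vertex may be encoded by the set
  of its outgoing arrows, each given by its label and its target: \<open>(j, v) |\<in>| out u\<close> says that
  there is an arrow from \<open>u\<close> to \<open>v\<close> with label \<open>j\<close>.
\<close>

datatype 'n vertex = Vertex (out: "('n \<times> 'n vertex) fset")

text \<open>
  The lower half of a diamond: arrows \<open>v \<rightarrow> w\<close> with label \<open>i\<close> and \<open>v' \<rightarrow> w\<close> with label \<open>j\<close>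
  that trigger a diamond completion.
\<close>

definition half_diamond ::
  "('n, 'k::field) mpolynomial set \<Rightarrow> 'n vertex set \<Rightarrow>
   'n vertex \<Rightarrow> 'n \<Rightarrow> 'n vertex \<Rightarrow> 'n \<Rightarrow> 'n vertex \<Rightarrow> bool" where
  "half_diamond I V v i v' j w \<longleftrightarrow>
     v \<in> V \<and> v' \<in> V \<and> v \<noteq> v' \<and> (i, w) |\<in>| out v \<and> (j, w) |\<in>| out v' \<and> i \<noteq> j \<and> X i * X j \<notin> I"

text \<open>
  The vertices added over the set \<open>V\<close> of vertices of one degree, before merging, each represented
  by the set of its outgoing arrows. (Added vertices with the same set of outgoing arrows get merged
  anyway, so nothing is lost by not counting them separately.)
\<close>

definition columns ::
  "('n, 'k::field) mpolynomial set \<Rightarrow> 'n vertex set \<Rightarrow> ('n \<times> 'n vertex) set set" where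
  "columns I V = {{(j, v)} |j v. v \<in> V \<and> (\<exists>i w. (i, w) |\<in>| out v \<and> X i * X j \<in> I)}"

definition diamonds ::
  "('n, 'k::field) mpolynomial set \<Rightarrow> 'n vertex set \<Rightarrow> ('n \<times> 'n vertex) set set" where
  "diamonds I V = {{(j, v), (i, v')} |v i v' j. \<exists>w. half_diamond I V v i v' j w}"

text \<open>
  Added vertices sharing an arrow are identified; the identification propagates transitively, and
  the resulting vertex keeps all the outgoing arrows.
\<close>

definition merge :: "'a set set \<Rightarrow> 'a set set" where
  "merge S = {\<Union>{B. (A, B) \<in> {(A, B). A \<in> S \<and> B \<in> S \<and> A \<inter> B \<noteq> {}}\<^sup>*} |A. A \<in> S}"

definition completion ::
  "('n, 'k::field) mpolynomial set \<Rightarrow> 'n vertex set \<Rightarrow> 'n vertex set" where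
  "completion I V = {u. fset (out u) \<in> merge (columns I V \<union> diamonds I V)}"

definition vertex0 :: "'n vertex" where
  "vertex0 = Vertex {||}"

definition vertex1 :: "'n \<Rightarrow> 'n vertex" where
  "vertex1 i = Vertex {|(i, vertex0)|}"

fun vertices :: "('n, 'k::field) mpolynomial set \<Rightarrow> 'n \<Rightarrow> nat \<Rightarrow> 'n vertex set" where
  "vertices I i 0 = {vertex0}"
| "vertices I i (Suc 0) = {vertex1 i}"
| "vertices I i (Suc (Suc d)) = completion I (vertices I i (Suc d))"

text \<open>
  The vertex sets are finite. In particular \<open>completion\<close> loses nothing by admitting only vertices
  with finitely many outgoing arrows: every merged set of arrows is finite.
\<close>

lemma merge_subset:
  assumes "E \<in> merge S"
  shows "E \<subseteq> \<Union>S"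
proof -
  obtain A where A: "A \<in> S"
    and E: "E = \<Union>{B. (A, B) \<in> {(A, B). A \<in> S \<and> B \<in> S \<and> A \<inter> B \<noteq> {}}\<^sup>*}"
    using assms unfolding merge_def by blast
  have "B \<in> S" if "(A, B) \<in> {(A, B). A \<in> S \<and> B \<in> S \<and> A \<inter> B \<noteq> {}}\<^sup>*" for B
    using that A by (induction rule: rtrancl_induct) auto
  then show ?thesis unfolding E by blast
qed

lemma added_subset: "\<Union>(columns I V \<union> diamonds I V) \<subseteq> UNIV \<times> V"
  by (auto simp: columns_def diamonds_def half_diamond_def)

lemma merged_finite:
  fixes V :: "'n::finite vertex set"
  assumes "finite V" "E \<in> merge (columns I V \<union> diamonds I V)"
  shows "finite E"
proof (rule finite_subset)
  show "E \<subseteq> UNIV \<times> V"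
    using merge_subset[OF assms(2)] added_subset by (rule subset_trans)
qed (use assms(1) in simp)

lemma completion_realizes_merged:
  fixes V :: "'n::finite vertex set"
  assumes "finite V" "E \<in> merge (columns I V \<union> diamonds I V)"
  shows "\<exists>!u. u \<in> completion I V \<and> fset (out u) = E"
proof -
  obtain F where F: "fset F = E"
    using merged_finite[OF assms] by (metis finite_fset fset_cases mem_Collect_eq)
  show ?thesis
  proof (rule ex1I)
    show "Vertex F \<in> completion I V \<and> fset (out (Vertex F)) = E"
      using F assms(2) by (simp add: completion_def)
    show "u = Vertex F" if "u \<in> completion I V \<and> fset (out u) = E" for u
      using that F by (metis fset_inject vertex.collapse)
  qed
qed

lemma finite_completion:
  fixes V :: "'n::finite vertex set"
  assumes "finite V"
  shows "finite (completion I V)"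
proof (rule finite_imageD)
  have "(\<lambda>u. fset (out u)) ` completion I V \<subseteq> Pow (UNIV \<times> V)"
    using merge_subset[of _ "columns I V \<union> diamonds I V"] added_subset[of I V]
    unfolding completion_def by blast
  then show "finite ((\<lambda>u. fset (out u)) ` completion I V)"
    using assms by (simp add: finite_subset)
  show "inj_on (\<lambda>u. fset (out u)) (completion I V)"
    by (rule inj_onI) (metis fset_inject vertex.collapse)
qed

lemma finite_vertices:
  fixes i :: "'n::finite"
  shows "finite (vertices I i d)"
  by (induction I i d rule: vertices.induct) (simp_all add: finite_completion)

section \<open>Signs\<close>

datatype sign = Plus | Minus

text \<open>\<open>s u j v\<close> is the sign of the arrow from \<open>u\<close> to \<open>v\<close> with label \<open>j\<close>.\<close>

type_synonym 'n signing = "'n vertex \<Rightarrow> 'n \<Rightarrow> 'n vertex \<Rightarrow> sign"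

definition one_differs :: "sign \<Rightarrow> sign \<Rightarrow> sign \<Rightarrow> sign \<Rightarrow> bool" where
  "one_differs a b c d \<longleftrightarrow>
     (a \<noteq> b \<and> b = c \<and> c = d) \<or> (b \<noteq> a \<and> a = c \<and> c = d) \<or>
     (c \<noteq> a \<and> a = b \<and> b = d) \<or> (d \<noteq> a \<and> a = b \<and> b = c)"

text \<open>
  Which of the four arrows of a diamond carries the exceptional sign is left open. Insisting on
  completing with two plus signs every diamond whose lower half has exactly one minus sign would
  make the procedure impossible in general: once five pairwise different variables have nonzero
  pairwise products and are all killed by the initial variable, the requirements on overlapping
  (merged) diamonds contradict each other, wherever the other signs are placed.
\<close>

definition admissible_signing ::
  "('n, 'k::field) mpolynomial set \<Rightarrow> 'n \<Rightarrow> 'n signing \<Rightarrow> bool" where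
  "admissible_signing I i\<^sub>0 s \<longleftrightarrow>
     s (vertex1 i\<^sub>0) i\<^sub>0 vertex0 = Plus \<and>
     (\<forall>d. \<forall>u \<in> vertices I i\<^sub>0 (d + 2). \<forall>v i v' j w.
        half_diamond I (vertices I i\<^sub>0 (d + 1)) v i v' j w \<and> (j, v) |\<in>| out u \<and> (i, v') |\<in>| out u \<longrightarrow>
        one_differs (s u j v) (s u i v') (s v i w) (s v' j w)) \<and>
     (\<forall>d. \<forall>u \<in> vertices I i\<^sub>0 (d + 2). \<forall>j v.
        (j, v) |\<in>| out u \<and> (\<forall>D \<in> diamonds I (vertices I i\<^sub>0 (d + 1)). (j, v) \<notin> D) \<longrightarrow>
        s u j v = Plus)"

section \<open>Modules and maps\<close>

text \<open>The free module with finite basis \<open>S\<close>. The fields \<open>mult\<close> and \<open>one\<close> are irrelevant.\<close>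

definition free_module :: "('r, 'm) ring_scheme \<Rightarrow> 's set \<Rightarrow> ('r, 's \<Rightarrow> 'r) module" where
  "free_module R S =
     \<lparr>carrier = S \<rightarrow>\<^sub>E carrier R,
      mult = (\<lambda>f g. undefined), one = undefined,
      zero = (\<lambda>v\<in>S. \<zero>\<^bsub>R\<^esub>),
      add = (\<lambda>f g. \<lambda>v\<in>S. f v \<oplus>\<^bsub>R\<^esub> g v),
      smult = (\<lambda>r f. \<lambda>v\<in>S. r \<otimes>\<^bsub>R\<^esub> f v)\<rparr>"

definition module_hom ::
  "('r, 'm) ring_scheme \<Rightarrow> ('r, 'a, 'c) module_scheme \<Rightarrow> ('r, 'b, 'd) module_scheme \<Rightarrow> ('a \<Rightarrow> 'b) set"
  where
  "module_hom R M N =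
     {f \<in> carrier M \<rightarrow> carrier N.
        (\<forall>x\<in>carrier M. \<forall>y\<in>carrier M. f (x \<oplus>\<^bsub>M\<^esub> y) = f x \<oplus>\<^bsub>N\<^esub> f y) \<and>
        (\<forall>r\<in>carrier R. \<forall>x\<in>carrier M. f (r \<odot>\<^bsub>M\<^esub> x) = r \<odot>\<^bsub>N\<^esub> f x)}"

text \<open>
  Complexes in nonnegative degrees, with \<open>\<delta> d\<close> mapping degree \<open>d + 1\<close> to degree \<open>d\<close>. The map out
  of degree \<open>0\<close> is zero and imposes no condition.
\<close>

definition chain_complex ::
  "('r, 'm) ring_scheme \<Rightarrow> (nat \<Rightarrow> ('r, 'a, 'c) module_scheme) \<Rightarrow> (nat \<Rightarrow> 'a \<Rightarrow> 'a) \<Rightarrow> bool" where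
  "chain_complex R M \<delta> \<longleftrightarrow>
     (\<forall>d. module R (M d)) \<and>
     (\<forall>d. \<delta> d \<in> module_hom R (M (d + 1)) (M d)) \<and>
     (\<forall>d. \<forall>x\<in>carrier (M (d + 2)). \<delta> d (\<delta> (d + 1) x) = \<zero>\<^bsub>M d\<^esub>)"

definition diagram_module ::
  "('n, 'k::field) mpolynomial set \<Rightarrow> 'n \<Rightarrow> nat \<Rightarrow>
   (('n, 'k) mpolynomial set, 'n vertex \<Rightarrow> ('n, 'k) mpolynomial set) module" where
  "diagram_module I i d = free_module (quot_ring I) (vertices I i d)"

definition signed ::
  "('r, 'm) ring_scheme \<Rightarrow> sign \<Rightarrow> 'r \<Rightarrow> 'r" where
  "signed R \<epsilon> r = (case \<epsilon> of Plus \<Rightarrow> r | Minus \<Rightarrow> \<ominus>\<^bsub>R\<^esub> r)"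

definition component ::
  "('n, 'k::field) mpolynomial set \<Rightarrow> 'n signing \<Rightarrow> 'n vertex \<Rightarrow> 'n vertex \<Rightarrow> ('n, 'k) mpolynomial set"
  where
  "component I s v w =
     (\<Oplus>\<^bsub>quot_ring I\<^esub>a\<in>{a. (a, w) |\<in>| out v}. signed (quot_ring I) (s v a w) (xbar I a))"

definition diagram_map ::
  "('n, 'k::field) mpolynomial set \<Rightarrow> 'n \<Rightarrow> 'n signing \<Rightarrow> nat \<Rightarrow>
   ('n vertex \<Rightarrow> ('n, 'k) mpolynomial set) \<Rightarrow> 'n vertex \<Rightarrow> ('n, 'k) mpolynomial set" where
  "diagram_map I i s d f =
     (\<lambda>w\<in>vertices I i d.
        \<Oplus>\<^bsub>quot_ring I\<^esub>v\<in>vertices I i (d + 1). component I s v w \<otimes>\<^bsub>quot_ring I\<^esub> f v)"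

end

theory Submission
  imports Defs
begin

text \<open>
  Call labels \<open>a\<close>, \<open>b\<close> with \<open>a \<noteq> b\<close> and \<open>X a * X b \<notin> I\<close> independent. Identify words that
  differ by swapping adjacent independent letters, and forbid words equivalent to one with a factor
  \<open>a a\<close> where \<open>X a * X a \<notin> I\<close>. The vertices of positive degree \<open>d\<close> can be pictured as the resulting
  classes of words of length \<open>d\<close>, restricted to those in which every representative starts with the
  initial label; an arrow \<open>u \<rightarrow> v\<close> with label \<open>j\<close> says that \<open>u\<close> arises from \<open>v\<close> by appending \<open>j\<close>.
  Column completion appends a letter that does not commute with one of the possible last letters;
  diamond completion records that \<open>w i j = w j i\<close> for independent \<open>i\<close> and \<open>j\<close>. The possible last
  letters of a word are pairwise independent, so any two arrows out of one vertex are the upper half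
  of a diamond, however they came to be merged.

  The words serve as a picture only. The properties of the diagram that they make visible are
  collected in the locale \<open>stage\<close>, about two consecutive vertex sets, and shown to reproduce
  themselves under completion (\<open>stage_completion\<close>). The decisive one is
  \<open>path_completes\<close>: a path \<open>u \<rightarrow> v \<rightarrow> w\<close> with labels \<open>j\<close>, \<open>i\<close> and \<open>X i * X j \<notin> I\<close> has \<open>i \<noteq> j\<close>
  and is one side of a diamond, the other side having the same labels in the other order.

  That the composition vanishes is then immediate: a path with \<open>X i * X j \<in> I\<close> contributes zero, and
  the other paths from \<open>u\<close> to \<open>w\<close> fall into pairs with the same product \<open>x\<^sub>i x\<^sub>j\<close> and, because three
  signs of a diamond agree and one differs, with opposite signs (\<open>composition_component_zero\<close>).

  For an admissible signing, one has to make the diamonds anticommute. Choose one arrow out of every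
  vertex, let it carry a plus sign, and let the diamonds containing it dictate the signs of the other
  arrows out of that vertex. A diamond below \<open>u\<close> that avoids the chosen arrow forms, together with
  that arrow, the top of a cube. Every edge lies in two of the six faces of the cube, so an even
  number of the faces commute rather than anticommute; as five of them anticommute by construction
  or by induction, so does the sixth (\<open>anticommuting_completion\<close>).
\<close>

section \<open>Merging\<close>

lemma merge_cover:
  assumes "A \<in> S"
  shows "\<exists>E\<in>merge S. A \<subseteq> E"
  using assms unfolding merge_def by blast

text \<open>
  The members of \<open>merge S\<close> are the unions of the connected components of the overlap relation, and
  that relation is symmetric.
\<close>

lemma merge_disjoint:
  assumes "E \<in> merge S" "E' \<in> merge S" "a \<in> E" "a \<in> E'"
  shows "E = E'"
proof -
  let ?r = "{(A, B). A \<in> S \<and> B \<in> S \<and> A \<inter> B \<noteq> {}}"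
  have "sym ?r" by (auto simp: sym_def)
  then have sym: "(B, A) \<in> ?r\<^sup>*" if "(A, B) \<in> ?r\<^sup>*" for A B
    using that by (meson sym_rtrancl symD)
  obtain A A' where A: "A \<in> S" "E = \<Union>{B. (A, B) \<in> ?r\<^sup>*}"
    and A': "A' \<in> S" "E' = \<Union>{B. (A', B) \<in> ?r\<^sup>*}"
    using assms(1,2) unfolding merge_def by blast
  obtain B B' where B: "(A, B) \<in> ?r\<^sup>*" "a \<in> B" and B': "(A', B') \<in> ?r\<^sup>*" "a \<in> B'"
    using assms(3,4) unfolding A(2) A'(2) by blast
  have in_S: "D \<in> S" if "(C, D) \<in> ?r\<^sup>*" "C \<in> S" for C D
    using that by (induction rule: rtrancl_induct) auto
  have "(B, B') \<in> ?r"
    using B B' in_S A(1) A'(1) by blast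
  then have "(A, A') \<in> ?r\<^sup>*"
    using B(1) sym[OF B'(1)] by (meson r_into_rtrancl rtrancl_trans)
  then have "(A, C) \<in> ?r\<^sup>* \<longleftrightarrow> (A', C) \<in> ?r\<^sup>*" for C
    using sym by (meson rtrancl_trans)
  then show ?thesis unfolding A(2) A'(2) by simp
qed

text \<open>
  A transitive relation that holds throughout each set before merging passes along a chain of
  overlapping sets through common elements. It is used to see that merging relates no more arrows
  than diamonds already do.
\<close>

lemma merge_related:
  assumes related: "\<And>A a b. A \<in> S \<Longrightarrow> a \<in> A \<Longrightarrow> b \<in> A \<Longrightarrow> r a b"
    and trans: "\<And>a b c. r a b \<Longrightarrow> r b c \<Longrightarrow> r a c"
    and E: "E \<in> merge S" "a \<in> E" "b \<in> E"
  shows "r a b"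
proof -
  let ?r = "{(A, B). A \<in> S \<and> B \<in> S \<and> A \<inter> B \<noteq> {}}"
  obtain A where A: "A \<in> S" "E = \<Union>{B. (A, B) \<in> ?r\<^sup>*}"
    using E(1) unfolding merge_def by blast
  have *: "(\<forall>x\<in>A. \<forall>y\<in>B. r x y \<and> r y x) \<and> B \<in> S" if "(A, B) \<in> ?r\<^sup>*" for B
    using that
  proof (induction rule: rtrancl_induct)
    case base
    then show ?case using related A(1) by blast
  next
    case (step B C)
    then obtain c where c: "c \<in> B" "c \<in> C" and "C \<in> S" by blast
    then show ?case using step.IH related trans by meson
  qed
  obtain B C where BC: "(A, B) \<in> ?r\<^sup>*" "a \<in> B" "(A, C) \<in> ?r\<^sup>*" "b \<in> C"
    using E(2,3) unfolding A(2) by blast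
  show ?thesis
  proof (cases "A = {}")
    case True
    \<comment> \<open>The empty set overlaps nothing, itself included, so its component consists of it alone.\<close>
    have "B = {}" using BC(1) True by (induction rule: converse_rtrancl_induct) auto
    then show ?thesis using BC(2) by simp
  next
    case False
    then show ?thesis using BC * trans by (meson all_not_in_conv)
  qed
qed

section \<open>Consecutive stages of the procedure\<close>

text \<open>
  An arrow is determined by any two of its source, its target and its label.
\<close>

locale arrows_determined =
  fixes V :: "'n vertex set"
  assumes source_unique: "v \<in> V \<Longrightarrow> v' \<in> V \<Longrightarrow> a |\<in>| out v \<Longrightarrow> a |\<in>| out v' \<Longrightarrow> v = v'"
    and label_unique: "v \<in> V \<Longrightarrow> (i, w) |\<in>| out v \<Longrightarrow> (j, w) |\<in>| out v \<Longrightarrow> i = j"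
    and target_unique: "v \<in> V \<Longrightarrow> (i, w) |\<in>| out v \<Longrightarrow> (i, w') |\<in>| out v \<Longrightarrow> w = w'"

text \<open>
  What the procedure preserves, for the vertices \<open>W\<close> of one degree and \<open>V\<close> of the next. In the
  picture of partially commutative words, \<open>diamond_below\<close> says that two possible last letters of a
  word are independent and can be removed in either order, and \<open>path_completes\<close> that the last two
  letters of a word can be swapped if the corresponding variables have a nonzero product, in which
  case they are different. The last two assumptions say that \<open>V\<close> contains everything that the
  completion rules add above \<open>W\<close>.
\<close>

locale stage = lower: arrows_determined W + arrows_determined V
  for W V :: "'n::finite vertex set" +
  fixes I :: "('n, 'k::field) mpolynomial set"
  assumes finite_stage: "finite V"
    and target_in: "v \<in> V \<Longrightarrow> (i, w) |\<in>| out v \<Longrightarrow> w \<in> W"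
    and diamond_below: "u \<in> V \<Longrightarrow> (j, v) |\<in>| out u \<Longrightarrow> (i, v') |\<in>| out u \<Longrightarrow> (j, v) \<noteq> (i, v') \<Longrightarrow>
      i \<noteq> j \<and> X i * X j \<notin> I \<and> (\<exists>w. (i, w) |\<in>| out v \<and> (j, w) |\<in>| out v')"
    and path_completes: "u \<in> V \<Longrightarrow> (j, v) |\<in>| out u \<Longrightarrow> (i, w) |\<in>| out v \<Longrightarrow> X i * X j \<notin> I \<Longrightarrow>
      i \<noteq> j \<and> (\<exists>v'. (i, v') |\<in>| out u \<and> (j, w) |\<in>| out v')"
    and column_above: "v \<in> W \<Longrightarrow> (i, w) |\<in>| out v \<Longrightarrow> X i * X j \<in> I \<Longrightarrow> \<exists>u\<in>V. (j, v) |\<in>| out u"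
    and diamond_above: "half_diamond I W v i v' j w \<Longrightarrow>
      \<exists>u\<in>V. (j, v) |\<in>| out u \<and> (i, v') |\<in>| out u"

lemma half_diamond_sym:
  "half_diamond I V v i v' j w \<Longrightarrow> half_diamond I V v' j v i w"
  by (auto simp: half_diamond_def mult.commute)

context stage
begin

lemma half_diamondI:
  assumes "v \<in> V" "v' \<in> V" "(i, w) |\<in>| out v" "(j, w) |\<in>| out v'" "i \<noteq> j" "X i * X j \<notin> I"
  shows "half_diamond I V v i v' j w"
  using assms label_unique unfolding half_diamond_def by blast

lemma completion_arrow_cases:
  assumes "u \<in> completion I V" "(j, v) |\<in>| out u"
  obtains (column) i w where "v \<in> V" "(i, w) |\<in>| out v" "X i * X j \<in> I"
  | (diamond) i w v' where "half_diamond I V v i v' j w"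
proof -
  have "(j, v) \<in> \<Union>(columns I V \<union> diamonds I V)"
    using assms merge_subset unfolding completion_def by blast
  then consider (col) "{(j, v)} \<in> columns I V"
    | (dia) A where "A \<in> diamonds I V" "(j, v) \<in> A"
    by (auto simp: columns_def)
  then show ?thesis
  proof cases
    case col
    then show ?thesis using column by (auto simp: columns_def)
  next
    case dia
    then obtain x i y l w where "half_diamond I V x i y l w" "(j, v) = (l, x) \<or> (j, v) = (i, y)"
      by (auto simp: diamonds_def)
    then show ?thesis using diamond half_diamond_sym by (metis prod.inject)
  qed
qed

lemma completion_target:
  assumes "u \<in> completion I V" "(j, v) |\<in>| out u"
  shows "v \<in> V"
  using assms by (cases rule: completion_arrow_cases) (auto simp: half_diamond_def)

lemma completion_source_unique:
  assumes "u \<in> completion I V" "u' \<in> completion I V" "a |\<in>| out u" "a |\<in>| out u'"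
  shows "u = u'"
  using assms merge_disjoint unfolding completion_def
  by (metis (mono_tags, lifting) fset_inject mem_Collect_eq vertex.expand)

lemma completion_cover:
  assumes "A \<in> columns I V \<union> diamonds I V"
  shows "\<exists>u\<in>completion I V. A \<subseteq> fset (out u)"
  using merge_cover[OF assms] completion_realizes_merged[OF finite_stage] by metis

lemma completion_column:
  assumes "v \<in> V" "(i, w) |\<in>| out v" "X i * X j \<in> I"
  shows "\<exists>u\<in>completion I V. (j, v) |\<in>| out u"
proof -
  have "{(j, v)} \<in> columns I V" using assms unfolding columns_def by blast
  then show ?thesis using completion_cover[of "{(j, v)}"] by auto
qed

lemma completion_diamond:
  assumes "half_diamond I V v i v' j w"
  shows "\<exists>u\<in>completion I V. (j, v) |\<in>| out u \<and> (i, v') |\<in>| out u"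
proof -
  have "{(j, v), (i, v')} \<in> diamonds I V" using assms unfolding diamonds_def by blast
  then show ?thesis using completion_cover[of "{(j, v), (i, v')}"] by auto
qed

text \<open>
  It is enough to find an arrow with label \<open>j\<close> onto \<open>w\<close> from a vertex of \<open>V\<close>: diamond completion
  then applies to it and \<open>v \<rightarrow> w\<close>, and the vertex it adds must be \<open>u\<close>, because it shares the arrow
  onto \<open>v\<close> with label \<open>j\<close>. If the latter arrow comes from a diamond with \<open>v \<rightarrow> w\<close> as a lower edge,
  then the opposite lower edge is as wanted. Otherwise, the rule that produced it also applies one
  degree lower, at \<open>w\<close> instead of \<open>v\<close>, and yields the arrow onto \<open>w\<close>.
\<close>

lemma completion_path_completes:
  assumes u: "u \<in> completion I V" "(j, v) |\<in>| out u" and v: "(i, w) |\<in>| out v"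
    and ij: "X i * X j \<notin> I"
  shows "i \<noteq> j \<and> (\<exists>v'. (i, v') |\<in>| out u \<and> (j, w) |\<in>| out v')"
proof -
  have vV: "v \<in> V" using completion_target u .
  have "i \<noteq> j \<and> (\<exists>v'\<in>V. (j, w) |\<in>| out v')"
    using u
  proof (cases rule: completion_arrow_cases)
    case (column k w')
    then have "(k, w') \<noteq> (i, w)" using ij by auto
    \<comment> \<open>The label \<open>k\<close> that allowed the column over \<open>v\<close> also labels an arrow out of \<open>w\<close>.\<close>
    then obtain z where z: "(k, z) |\<in>| out w" and ki: "X k * X i \<notin> I"
      using diamond_below[OF vV v column(2)] by blast
    have "i \<noteq> j" using ki column(3) by auto
    moreover have "w \<in> W" using target_in[OF vV v] .
    ultimately show ?thesis using column_above[OF _ z column(3)] by blast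
  next
    case (diamond k w' v2)
    then have d: "v2 \<in> V" "v2 \<noteq> v" "(k, w') |\<in>| out v" "(j, w') |\<in>| out v2" "k \<noteq> j"
      "X k * X j \<notin> I"
      by (auto simp: half_diamond_def)
    show ?thesis
    proof (cases "(i, w) = (k, w')")
      case True
      then show ?thesis using d by auto
    next
      case False
      then obtain z where z: "(k, z) |\<in>| out w" "(i, z) |\<in>| out w'"
        using diamond_below[OF vV v d(3)] by blast
      obtain w'' where w'': "(i, w'') |\<in>| out v2" "(j, z) |\<in>| out w''" and "i \<noteq> j"
        using path_completes[OF d(1) d(4) z(2) ij] by blast
      have W: "w \<in> W" "w'' \<in> W" using target_in vV v d(1) w'' by blast+
      \<comment> \<open>Completing this half diamond gives the arrow with label \<open>j\<close> onto \<open>w\<close>.\<close>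
      have "half_diamond I W w k w'' j z"
        using lower.label_unique W z w'' d(5,6) unfolding half_diamond_def by blast
      then show ?thesis using diamond_above \<open>i \<noteq> j\<close> by blast
    qed
  qed
  then obtain v' where v': "v' \<in> V" "(j, w) |\<in>| out v'" and "i \<noteq> j" by blast
  then obtain u' where u': "u' \<in> completion I V" "(j, v) |\<in>| out u'" "(i, v') |\<in>| out u'"
    using completion_diamond[OF half_diamondI[OF vV v'(1) v v'(2) _ ij]] by blast
  have "u' = u" using completion_source_unique[OF u'(1) u(1) u'(2) u(2)] .
  then show ?thesis using u' v' \<open>i \<noteq> j\<close> by blast
qed

text \<open>
  Whether two arrows are added by a common diamond is a transitive relation up to equality. For three
  labels \<open>i\<close>, \<open>j\<close>, \<open>l\<close> in play, \<open>y\<close> and \<open>y'\<close> below are the results of removing \<open>l\<close> from \<open>v\<close> and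
  \<open>j\<close> from \<open>v''\<close>; they agree because they have the arrow with label \<open>i\<close> onto \<open>z\<close> in common.
\<close>

lemma half_diamond_trans:
  assumes "half_diamond I V v i v' j w" and "half_diamond I V v' l v'' i w'"
  shows "(j, v) = (l, v'') \<or> (\<exists>z. half_diamond I V v l v'' j z)"
proof -
  have 1: "v \<in> V" "v' \<in> V" "(i, w) |\<in>| out v" "(j, w) |\<in>| out v'" "i \<noteq> j" "X i * X j \<notin> I"
    using assms(1) by (auto simp: half_diamond_def)
  have 2: "v'' \<in> V" "(l, w') |\<in>| out v'" "(i, w') |\<in>| out v''" "l \<noteq> i" "X l * X i \<notin> I"
    using assms(2) by (auto simp: half_diamond_def)
  have 3: "X j * X i \<notin> I" "X i * X l \<notin> I" using 1(6) 2(5) by (simp_all add: mult.commute)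
  show ?thesis
  proof (cases "j = l")
    case True
    then have "w = w'" using target_unique[OF 1(2,4)] 2(2) by blast
    then have "v = v''" using source_unique[OF 1(1) 2(1) 1(3)] 2(3) by blast
    then show ?thesis using True by blast
  next
    case False
    then obtain z where z: "(l, z) |\<in>| out w" "(j, z) |\<in>| out w'" and lj: "X l * X j \<notin> I"
      using diamond_below[OF 1(2) 1(4) 2(2)] by blast
    obtain y where y: "(l, y) |\<in>| out v" "(i, z) |\<in>| out y"
      using path_completes[OF 1(1) 1(3) z(1) 2(5)] by blast
    obtain y' where y': "(j, y') |\<in>| out v''" "(i, z) |\<in>| out y'"
      using path_completes[OF 2(1) 2(3) z(2) 3(1)] by blast
    have "y \<in> W" "y' \<in> W" using target_in 1(1) 2(1) y y' by blast+
    then have "y = y'" using lower.source_unique y(2) y'(2) by blast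
    then have "half_diamond I V v l v'' j y"
      using half_diamondI 1(1) 2(1) y(1) y'(1) False lj by metis
    then show ?thesis by blast
  qed
qed

lemma completion_diamond_below:
  assumes u: "u \<in> completion I V" "(j, v) |\<in>| out u" "(i, v') |\<in>| out u"
    and distinct: "(j, v) \<noteq> (i, v')"
  shows "\<exists>w. half_diamond I V v i v' j w"
proof -
  define r where "r a b \<longleftrightarrow> a = b \<or> (\<exists>w. half_diamond I V (snd a) (fst b) (snd b) (fst a) w)"
    for a b :: "'n \<times> 'n vertex"
  have related: "r a b" if "A \<in> columns I V \<union> diamonds I V" "a \<in> A" "b \<in> A" for A a b
    using that half_diamond_sym unfolding columns_def diamonds_def r_def by fastforce
  have trans: "r a c" if "r a b" "r b c" for a b c
    using that half_diamond_trans unfolding r_def by (metis prod.collapse)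
  have "fset (out u) \<in> merge (columns I V \<union> diamonds I V)"
    using u(1) unfolding completion_def by blast
  then have "r (j, v) (i, v')"
    using merge_related[of "columns I V \<union> diamonds I V" r] related trans u(2,3) by blast
  then show ?thesis using distinct unfolding r_def by auto
qed

lemma arrows_determined_completion: "arrows_determined (completion I V)"
proof
  fix u u' a
  assume "u \<in> completion I V" "u' \<in> completion I V" "a |\<in>| out u" "a |\<in>| out u'"
  then show "u = u'" by (rule completion_source_unique)
next
  fix u i v j
  assume u: "u \<in> completion I V" "(i, v) |\<in>| out u" "(j, v) |\<in>| out u"
  show "i = j"
    using completion_diamond_below[OF u] by (auto simp: half_diamond_def)
next
  fix u i v v'
  assume u: "u \<in> completion I V" "(i, v) |\<in>| out u" "(i, v') |\<in>| out u"
  show "v = v'"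
    using completion_diamond_below[OF u] by (auto simp: half_diamond_def)
qed

lemma stage_completion: "stage V (completion I V) I"
proof -
  interpret upper: arrows_determined "completion I V" by (rule arrows_determined_completion)
  show ?thesis
  proof
    show "finite (completion I V)" using finite_stage by (rule finite_completion)
    show "v \<in> V" if "u \<in> completion I V" "(j, v) |\<in>| out u" for u j v
      using completion_target that .
    show "i \<noteq> j \<and> X i * X j \<notin> I \<and> (\<exists>w. (i, w) |\<in>| out v \<and> (j, w) |\<in>| out v')"
      if "u \<in> completion I V" "(j, v) |\<in>| out u" "(i, v') |\<in>| out u" "(j, v) \<noteq> (i, v')"
      for u j v i v'
      using completion_diamond_below[OF that] unfolding half_diamond_def by blast
  qed (fact completion_path_completes completion_column completion_diamond)+
qed

end

text \<open>
  Here everything is vacuous or trivial, as the vertex of degree \<open>0\<close> has no outgoing arrow and the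
  vertex of degree \<open>1\<close> has only one.
\<close>

lemma stage_initial:
  fixes i :: "'n::finite"
  shows "stage {vertex0} {vertex1 i} I"
  by standard (auto simp: vertex0_def vertex1_def half_diamond_def)

lemma stage_vertices:
  fixes i :: "'n::finite"
  shows "stage (vertices I i d) (vertices I i (Suc d)) I"
proof (induction d)
  case 0
  show ?case using stage_initial by simp
next
  case (Suc d)
  then show ?case using stage.stage_completion by (cases d) auto
qed

section \<open>Signs\<close>

text \<open>
  The condition says that the number of minus signs is odd, so it is an equation between parities
  and can be added up over the faces of a cube.
\<close>

lemma one_differs_iff: 
  "one_differs a b c d \<longleftrightarrow> ((a = Plus) = (b = Plus)) \<noteq> ((c = Plus) = (d = Plus))"
  by (cases a; cases b; cases c; cases d) (auto simp: one_differs_def)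

definition chosen :: "'n vertex \<Rightarrow> 'n \<times> 'n vertex" where
  "chosen u = (SOME a. a |\<in>| out u)"

lemma chosen_in: "a |\<in>| out u \<Longrightarrow> chosen u |\<in>| out u"
  unfolding chosen_def by (rule someI)

lemma wf_arrows: "wf {(v, u). \<exists>j. (j, v) |\<in>| out u}"
proof (rule wfUNIVI)
  fix P :: "'a vertex \<Rightarrow> bool" and u
  assume step: "\<forall>u. (\<forall>v. (v, u) \<in> {(v, u). \<exists>j. (j, v) |\<in>| out u} \<longrightarrow> P v) \<longrightarrow> P u"
  show "P u"
  proof (induction u)
    case (Vertex A)
    then show ?case using step by (force simp: snds.simps)
  qed
qed

text \<open>
  The chosen arrow out of \<open>u\<close>, and by convention every triple that is no arrow, gets a plus sign.
  Any other arrow spans a diamond with the chosen one, whose bottom vertex is \<open>w\<close>, and gets the sign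
  that makes the number of minus signs in this diamond odd.
\<close>

function cube_sign :: "'n signing" where
  "cube_sign u j v =
     (if (j, v) |\<in>| out u \<and> (j, v) \<noteq> chosen u then
        let w = SOME w. (j, w) |\<in>| out (snd (chosen u)) \<and> (fst (chosen u), w) |\<in>| out v in
        if cube_sign (snd (chosen u)) j w = cube_sign v (fst (chosen u)) w then Minus else Plus
      else Plus)"
  by auto
termination
proof (relation "inv_image {(v, u). \<exists>j. (j, v) |\<in>| out u} fst")
  show "wf (inv_image {(v, u). \<exists>j. (j, v) |\<in>| out u} fst)"
    using wf_arrows by (rule wf_inv_image)
qed (auto, metis chosen_in prod.collapse)

declare cube_sign.simps [simp del]

text \<open>
  A variant of the diamond condition on signings that refers to the arrows below a single vertex set
  only, which suits the induction on the degree.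
\<close>

definition anticommuting :: "'n signing \<Rightarrow> 'n vertex set \<Rightarrow> bool" where
  "anticommuting s V \<longleftrightarrow>
     (\<forall>u\<in>V. \<forall>j v i v' w. (j, v) |\<in>| out u \<and> (i, v') |\<in>| out u \<and> (j, v) \<noteq> (i, v') \<and>
        (i, w) |\<in>| out v \<and> (j, w) |\<in>| out v' \<longrightarrow> one_differs (s u j v) (s u i v') (s v i w) (s v' j w))"

lemma (in stage) cube_sign_chosen:
  assumes u: "u \<in> completion I V" "(j, v) |\<in>| out u" "(i, v') |\<in>| out u" "(j, v) \<noteq> (i, v')"
    and w: "(i, w) |\<in>| out v" "(j, w) |\<in>| out v'" and chosen: "chosen u = (i, v')"
  shows "one_differs (cube_sign u j v) (cube_sign u i v') (cube_sign v i w) (cube_sign v' j w)"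
proof -
  have "v' \<in> V" using completion_target u(1,3) .
  then have w': "(SOME w. (j, w) |\<in>| out v' \<and> (i, w) |\<in>| out v) = w"
    using w target_unique by (metis (mono_tags, lifting) someI)
  have 1: "cube_sign u j v = (if cube_sign v' j w = cube_sign v i w then Minus else Plus)"
    using u chosen w' by (subst cube_sign.simps) (auto simp: Let_def)
  have 2: "cube_sign u i v' = Plus"
    using chosen by (subst cube_sign.simps) simp
  show ?thesis unfolding one_differs_iff 1 2
    by (cases "cube_sign v' j w"; cases "cube_sign v i w") simp_all
qed

text \<open>
  If neither of the two arrows out of \<open>u\<close> is the chosen one, the three arrows out of \<open>u\<close> span a cube.
  Its vertices are \<open>u\<close>, then \<open>v\<close>, \<open>v'\<close>, \<open>v0\<close>, then \<open>w\<close>, \<open>a\<close>, \<open>b\<close>, and \<open>z\<close> at the bottom. The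
  three lower faces anticommute by hypothesis and the two upper faces at the chosen arrow by
  construction. Each edge belongs to two faces, so adding the five parities leaves that of the
  remaining upper face.
\<close>

lemma (in stage) anticommuting_completion:
  assumes anti: "anticommuting cube_sign V"
  shows "anticommuting cube_sign (completion I V)"
  unfolding anticommuting_def
proof (intro ballI allI impI)
  interpret upper: stage V "completion I V" I by (rule stage_completion)
  fix u j v i v' w
  assume u: "u \<in> completion I V"
    and "(j, v) |\<in>| out u \<and> (i, v') |\<in>| out u \<and> (j, v) \<noteq> (i, v') \<and>
        (i, w) |\<in>| out v \<and> (j, w) |\<in>| out v'"
  then have v: "(j, v) |\<in>| out u" and v': "(i, v') |\<in>| out u" and dist: "(j, v) \<noteq> (i, v')"
    and w: "(i, w) |\<in>| out v" "(j, w) |\<in>| out v'" by auto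
  let ?s = cube_sign
  obtain k v0 where k: "chosen u = (k, v0)" by fastforce
  then have v0: "(k, v0) |\<in>| out u" using chosen_in v by metis
  consider "(k, v0) = (i, v')" | "(k, v0) = (j, v)" | "(k, v0) \<noteq> (i, v')" "(k, v0) \<noteq> (j, v)"
    by blast
  then show "one_differs (?s u j v) (?s u i v') (?s v i w) (?s v' j w)"
  proof cases
    case 1
    then show ?thesis using cube_sign_chosen[OF u v v' dist w] k by simp
  next
    case 2
    then have "one_differs (?s u i v') (?s u j v) (?s v' j w) (?s v i w)"
      using cube_sign_chosen[OF u v' v dist[symmetric] w(2,1)] k by simp
    then show ?thesis unfolding one_differs_iff by argo
  next
    case 3
    have V: "v \<in> V" "v' \<in> V" "v0 \<in> V" using u v v' v0 completion_target by blast+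
    obtain a where a: "(k, a) |\<in>| out v" "(j, a) |\<in>| out v0"
      using upper.diamond_below[OF u v v0] 3 by blast
    obtain b where b: "(k, b) |\<in>| out v'" "(i, b) |\<in>| out v0"
      using upper.diamond_below[OF u v' v0] 3 by blast
    have ne: "i \<noteq> j" "k \<noteq> i" "k \<noteq> j"
      using upper.diamond_below[OF u v v' dist] upper.diamond_below[OF u v v0]
        upper.diamond_below[OF u v' v0] 3 by auto
    obtain z where z: "(i, z) |\<in>| out a" "(j, z) |\<in>| out b"
      using diamond_below[OF V(3) a(2) b(2)] ne by auto
    obtain z' where z': "(i, z') |\<in>| out a" "(k, z') |\<in>| out w"
      using diamond_below[OF V(1) a(1) w(1)] ne by auto
    obtain z'' where z'': "(j, z'') |\<in>| out b" "(k, z'') |\<in>| out w"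
      using diamond_below[OF V(2) b(1) w(2)] ne by auto
    \<comment> \<open>The three lower faces meet in one bottom vertex.\<close>
    have "a \<in> W" "b \<in> W" using target_in V a b by blast+
    then have eq: "z' = z" "z'' = z" using lower.target_unique z z' z'' by blast+
    have "one_differs (?s v0 j a) (?s v0 i b) (?s a i z) (?s b j z)"
      using anti V(3) a(2) b(2) z ne unfolding anticommuting_def by blast
    moreover have "one_differs (?s v k a) (?s v i w) (?s a i z) (?s w k z)"
      using anti V(1) a(1) w(1) z' eq ne unfolding anticommuting_def by blast
    moreover have "one_differs (?s v' k b) (?s v' j w) (?s b j z) (?s w k z)"
      using anti V(2) b(1) w(2) z'' eq ne unfolding anticommuting_def by blast
    moreover have "one_differs (?s u j v) (?s u k v0) (?s v k a) (?s v0 j a)"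
      using cube_sign_chosen[OF u v v0 _ a k] 3 by auto
    moreover have "one_differs (?s u i v') (?s u k v0) (?s v' k b) (?s v0 i b)"
      using cube_sign_chosen[OF u v' v0 _ b k] 3 by auto
    ultimately show ?thesis unfolding one_differs_iff by argo
  qed
qed

lemma anticommuting_vertices:
  fixes i :: "'n::finite"
  shows "anticommuting cube_sign (vertices I i (Suc d))"
proof (induction d)
  case 0
  show ?case by (auto simp: anticommuting_def vertex1_def)
next
  case (Suc d)
  interpret stage "vertices I i d" "vertices I i (Suc d)" I by (rule stage_vertices)
  show ?case using anticommuting_completion Suc.IH by simp
qed

text \<open>
  Two arrows out of one vertex always form a diamond, so an arrow in no diamond is the only arrow out
  of its source, and hence the chosen one.
\<close>

lemma (in stage) cube_sign_column:
  assumes u: "u \<in> completion I V" "(j, v) |\<in>| out u"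
    and no_diamond: "\<forall>D\<in>diamonds I V. (j, v) \<notin> D"
  shows "cube_sign u j v = Plus"
proof -
  have "chosen u = (j, v)"
  proof (rule ccontr)
    assume "chosen u \<noteq> (j, v)"
    then obtain w where "half_diamond I V v (fst (chosen u)) (snd (chosen u)) j w"
      using completion_diamond_below[OF u] chosen_in[OF u(2)] by (metis prod.collapse)
    then have "{(j, v), chosen u} \<in> diamonds I V"
      unfolding diamonds_def by (smt (verit) mem_Collect_eq prod.collapse)
    then show False using no_diamond by blast
  qed
  then show ?thesis by (subst cube_sign.simps) simp
qed

lemma admissible_cube_sign:
  fixes i :: "'n::finite"
  shows "admissible_signing I i cube_sign"
  unfolding admissible_signing_def
proof (intro conjI allI ballI impI)
  have "chosen (vertex1 i) = (i, vertex0)"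
    using chosen_in[of "(i, vertex0)" "vertex1 i"] by (simp add: vertex1_def)
  then show "cube_sign (vertex1 i) i vertex0 = Plus" by (subst cube_sign.simps) simp
next
  fix d u v k v' j w
  assume "u \<in> vertices I i (d + 2)"
    and "half_diamond I (vertices I i (d + 1)) v k v' j w \<and> (j, v) |\<in>| out u \<and> (k, v') |\<in>| out u"
  then have "u \<in> vertices I i (Suc (Suc d))" "(j, v) |\<in>| out u" "(k, v') |\<in>| out u"
    "(j, v) \<noteq> (k, v')" "(k, w) |\<in>| out v" "(j, w) |\<in>| out v'"
    by (auto simp: half_diamond_def)
  then show "one_differs (cube_sign u j v) (cube_sign u k v') (cube_sign v k w) (cube_sign v' j w)"
    using anticommuting_vertices[of I i "Suc d"] unfolding anticommuting_def by blast
next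
  fix d u j v
  assume "u \<in> vertices I i (d + 2)"
    and "(j, v) |\<in>| out u \<and> (\<forall>D\<in>diamonds I (vertices I i (d + 1)). (j, v) \<notin> D)"
  then show "cube_sign u j v = Plus"
    using stage.cube_sign_column[OF stage_vertices[of I i d]] by simp
qed

section \<open>Finite sums in abelian groups\<close>

lemma (in abelian_monoid) finsum_exchange:
  assumes "finite A" "finite B" and f: "\<And>a b. a \<in> A \<Longrightarrow> b \<in> B \<Longrightarrow> f a b \<in> carrier G"
  shows "(\<Oplus>a\<in>A. \<Oplus>b\<in>B. f a b) = (\<Oplus>b\<in>B. \<Oplus>a\<in>A. f a b)"
  using assms(1) f
proof (induction A rule: finite_induct)
  case empty
  then show ?case by (simp add: finsum_zero)
next
  case (insert x F)
  have "(\<Oplus>a\<in>insert x F. \<Oplus>b\<in>B. f a b) = (\<Oplus>b\<in>B. f x b) \<oplus> (\<Oplus>b\<in>B. \<Oplus>a\<in>F. f a b)"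
    using insert by (subst finsum_insert) auto
  also have "\<dots> = (\<Oplus>b\<in>B. f x b \<oplus> (\<Oplus>a\<in>F. f a b))"
    using insert.prems by (intro finsum_addf[symmetric]) auto
  also have "\<dots> = (\<Oplus>b\<in>B. \<Oplus>a\<in>insert x F. f a b)"
    using insert by (intro finsum_cong') auto
  finally show ?case .
qed

text \<open>
  A sum vanishes if its nonzero terms can be matched in pairs of opposite terms. The matching is
  given as a relation, since in the application the partner of a term is obtained from an existence
  statement. The partner has to be a different index, since a nonzero term may be its own negative,
  for instance in characteristic two.
\<close>

lemma (in abelian_group) finsum_cancelling_pairs:
  assumes "finite S" "\<And>v. v \<in> S \<Longrightarrow> f v \<in> carrier G"
    and sym: "\<And>v v'. p v v' \<Longrightarrow> p v' v"
    and unique: "\<And>v v' v''. p v v' \<Longrightarrow> p v v'' \<Longrightarrow> v' = v''"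
    and cancel: "\<And>v. v \<in> S \<Longrightarrow> f v \<noteq> \<zero> \<Longrightarrow> \<exists>v'\<in>S. p v v' \<and> v' \<noteq> v \<and> f v' = \<ominus> f v"
  shows "(\<Oplus>v\<in>S. f v) = \<zero>"
  using assms(1,2) cancel
proof (induction S rule: finite_psubset_induct)
  case (psubset S)
  show ?case
  proof (cases "\<forall>v\<in>S. f v = \<zero>")
    case True
    then show ?thesis by (simp add: add.finprod_one_eqI)
  next
    case False
    then obtain v v' where v: "v \<in> S" "v' \<in> S" "p v v'" "v' \<noteq> v" "f v' = \<ominus> f v"
      using psubset.prems(2) by blast
    let ?S = "S - {v, v'}"
    have "\<exists>w'\<in>?S. p w w' \<and> w' \<noteq> w \<and> f w' = \<ominus> f w" if w: "w \<in> ?S" "f w \<noteq> \<zero>" for w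
    proof -
      obtain w' where w': "w' \<in> S" "p w w'" "w' \<noteq> w" "f w' = \<ominus> f w"
        using psubset.prems(2) w by blast
      have "w' \<noteq> v" "w' \<noteq> v'" using sym[OF w'(2)] v(3) sym[OF v(3)] unique w(1) by blast+
      then show ?thesis using w' by blast
    qed
    then have rest: "(\<Oplus>w\<in>?S. f w) = \<zero>"
      using psubset.IH[of ?S] psubset.prems(1) v(1) by blast
    have S: "S = insert v (insert v' ?S)" using v by blast
    have "(\<Oplus>w\<in>insert v (insert v' ?S). f w) = f v \<oplus> (f v' \<oplus> (\<Oplus>w\<in>?S. f w))"
      using v psubset.hyps psubset.prems(1)
      by (subst finsum_insert, simp, force, force, force, subst finsum_insert) force+
    then show ?thesis
      using S rest v psubset.prems(1) r_neg by auto
  qed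
qed

section \<open>Free modules and matrices\<close>

lemma (in cring) module_free_module: "module R (free_module R S)"
proof (rule moduleI)
  let ?M = "free_module R S"
  show "abelian_group ?M"
  proof (rule abelian_groupI)
    fix x y z assume "x \<in> carrier ?M" "y \<in> carrier ?M" "z \<in> carrier ?M"
    then show "x \<oplus>\<^bsub>?M\<^esub> y \<oplus>\<^bsub>?M\<^esub> z = x \<oplus>\<^bsub>?M\<^esub> (y \<oplus>\<^bsub>?M\<^esub> z)"
      by (auto simp: free_module_def PiE_iff a_assoc intro!: restrict_ext)
  next
    fix x y assume "x \<in> carrier ?M" "y \<in> carrier ?M"
    then show "x \<oplus>\<^bsub>?M\<^esub> y = y \<oplus>\<^bsub>?M\<^esub> x"
      by (auto simp: free_module_def PiE_iff a_comm intro!: restrict_ext)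
  next
    fix x assume x: "x \<in> carrier ?M"
    then show "\<zero>\<^bsub>?M\<^esub> \<oplus>\<^bsub>?M\<^esub> x = x"
      by (auto simp: free_module_def PiE_iff extensional_def)
    show "\<exists>y\<in>carrier ?M. y \<oplus>\<^bsub>?M\<^esub> x = \<zero>\<^bsub>?M\<^esub>"
      using x by (intro bexI[of _ "\<lambda>v\<in>S. \<ominus> x v"])
        (auto simp: free_module_def PiE_iff l_neg intro!: restrict_ext)
  qed (auto simp: free_module_def)
qed (auto simp: free_module_def PiE_iff l_distr r_distr m_assoc is_cring extensional_def
    intro!: restrict_ext)

lemma (in cring) matrix_in_module_hom:
  assumes "finite T" and c: "\<And>v w. v \<in> T \<Longrightarrow> w \<in> S \<Longrightarrow> c v w \<in> carrier R"
  shows "(\<lambda>f. \<lambda>w\<in>S. \<Oplus>v\<in>T. c v w \<otimes> f v) \<in> module_hom R (free_module R T) (free_module R S)"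
  unfolding module_hom_def
proof (intro CollectI conjI ballI)
  let ?F = "\<lambda>f. \<lambda>w\<in>S. \<Oplus>v\<in>T. c v w \<otimes> f v"
  show "?F \<in> carrier (free_module R T) \<rightarrow> carrier (free_module R S)"
    using c by (auto simp: free_module_def PiE_iff intro!: finsum_closed)
  fix x assume x: "x \<in> carrier (free_module R T)"
  then have xv: "v \<in> T \<Longrightarrow> x v \<in> carrier R" for v by (auto simp: free_module_def)
  {
    fix y assume "y \<in> carrier (free_module R T)"
    then have yv: "v \<in> T \<Longrightarrow> y v \<in> carrier R" for v by (auto simp: free_module_def)
    have "(\<Oplus>v\<in>T. c v w \<otimes> (\<lambda>v\<in>T. x v \<oplus> y v) v) =
        (\<Oplus>v\<in>T. c v w \<otimes> x v) \<oplus> (\<Oplus>v\<in>T. c v w \<otimes> y v)" if "w \<in> S" for w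
    proof -
      have "(\<Oplus>v\<in>T. c v w \<otimes> (\<lambda>v\<in>T. x v \<oplus> y v) v) = (\<Oplus>v\<in>T. c v w \<otimes> x v \<oplus> c v w \<otimes> y v)"
        using that c xv yv by (intro finsum_cong') (auto simp: r_distr)
      also have "\<dots> = (\<Oplus>v\<in>T. c v w \<otimes> x v) \<oplus> (\<Oplus>v\<in>T. c v w \<otimes> y v)"
        using that c xv yv by (intro finsum_addf) auto
      finally show ?thesis .
    qed
    then show "?F (x \<oplus>\<^bsub>free_module R T\<^esub> y) = ?F x \<oplus>\<^bsub>free_module R S\<^esub> ?F y"
      by (auto simp: free_module_def intro!: restrict_ext)
  }
  fix r assume r: "r \<in> carrier R"
  have "(\<Oplus>v\<in>T. c v w \<otimes> (\<lambda>v\<in>T. r \<otimes> x v) v) = r \<otimes> (\<Oplus>v\<in>T. c v w \<otimes> x v)" if "w \<in> S" for w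
  proof -
    have "r \<otimes> (\<Oplus>v\<in>T. c v w \<otimes> x v) = (\<Oplus>v\<in>T. r \<otimes> (c v w \<otimes> x v))"
      using that c xv r assms(1) by (intro finsum_rdistr) auto
    also have "\<dots> = (\<Oplus>v\<in>T. c v w \<otimes> (\<lambda>v\<in>T. r \<otimes> x v) v)"
      using that c xv r by (intro finsum_cong') (auto simp: m_lcomm)
    finally show ?thesis by simp
  qed
  then show "?F (r \<odot>\<^bsub>free_module R T\<^esub> x) = r \<odot>\<^bsub>free_module R S\<^esub> ?F x"
    by (auto simp: free_module_def intro!: restrict_ext)
qed

lemma (in cring) matrix_product_zero:
  assumes fin: "finite T" "finite U"
    and b: "\<And>u v. u \<in> U \<Longrightarrow> v \<in> T \<Longrightarrow> b u v \<in> carrier R"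
    and c: "\<And>v w. v \<in> T \<Longrightarrow> w \<in> S \<Longrightarrow> c v w \<in> carrier R"
    and zero: "\<And>u w. u \<in> U \<Longrightarrow> w \<in> S \<Longrightarrow> (\<Oplus>v\<in>T. c v w \<otimes> b u v) = \<zero>"
    and x: "x \<in> carrier (free_module R U)"
  shows "(\<lambda>w\<in>S. \<Oplus>v\<in>T. c v w \<otimes> (\<lambda>v\<in>T. \<Oplus>u\<in>U. b u v \<otimes> x u) v) = \<zero>\<^bsub>free_module R S\<^esub>"
proof -
  have xu: "u \<in> U \<Longrightarrow> x u \<in> carrier R" for u using x by (auto simp: free_module_def)
  have "(\<Oplus>v\<in>T. c v w \<otimes> (\<lambda>v\<in>T. \<Oplus>u\<in>U. b u v \<otimes> x u) v) = \<zero>" if w: "w \<in> S" for w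
  proof -
    have "(\<Oplus>v\<in>T. c v w \<otimes> (\<lambda>v\<in>T. \<Oplus>u\<in>U. b u v \<otimes> x u) v) =
        (\<Oplus>v\<in>T. \<Oplus>u\<in>U. c v w \<otimes> b u v \<otimes> x u)"
      using b c[OF _ w] xu fin
      by (intro finsum_cong') (auto simp: finsum_rdistr m_assoc intro!: finsum_cong' finsum_closed)
    also have "\<dots> = (\<Oplus>u\<in>U. \<Oplus>v\<in>T. c v w \<otimes> b u v \<otimes> x u)"
      using b c[OF _ w] xu fin by (intro finsum_exchange) auto
    also have "\<dots> = (\<Oplus>u\<in>U. (\<Oplus>v\<in>T. c v w \<otimes> b u v) \<otimes> x u)"
      using b c[OF _ w] xu fin
      by (intro finsum_cong') (auto simp: finsum_ldistr intro!: finsum_closed)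
    also have "\<dots> = \<zero>"
      using xu zero[OF _ w] by (simp add: add.finprod_one_eqI)
    finally show ?thesis .
  qed
  then show ?thesis by (auto simp: free_module_def intro!: restrict_ext)
qed

section \<open>The quotient ring\<close>

lemma cring_poly_ring: "cring (poly_ring :: ('n, 'k::field) mpolynomial ring)"
proof (rule cringI)
  show "abelian_group (poly_ring :: ('n, 'k) mpolynomial ring)"
    by (rule abelian_groupI)
      (auto simp: poly_ring_def add.assoc add.commute intro: exI[of _ "- _"])
  show "Group.comm_monoid (poly_ring :: ('n, 'k) mpolynomial ring)"
    by (rule comm_monoidI) (auto simp: poly_ring_def mult.assoc mult.commute)
qed (simp add: poly_ring_def distrib_right)

context
  fixes I :: "('n, 'k::field) mpolynomial set"
  assumes ideal: "ideal I poly_ring"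
begin

interpretation ideal I "poly_ring :: ('n, 'k) mpolynomial ring" by (rule ideal)

lemma cring_quot_ring: "cring (quot_ring I)"
  unfolding quot_ring_def by (rule quotient_is_cring[OF cring_poly_ring])

lemma xbar_closed: "xbar I i \<in> carrier (quot_ring I)"
  unfolding xbar_def quot_ring_def FactRing_def
  by (simp add: poly_ring_def a_rcosetsI[unfolded poly_ring_def] a_subset[unfolded poly_ring_def])

lemma xbar_mult_eq_zero:
  assumes "X i * X j \<in> I"
  shows "xbar I i \<otimes>\<^bsub>quot_ring I\<^esub> xbar I j = \<zero>\<^bsub>quot_ring I\<^esub>"
proof -
  have "xbar I i \<otimes>\<^bsub>quot_ring I\<^esub> xbar I j = I +>\<^bsub>poly_ring\<^esub> (X i * X j)"
    using rcoset_mult_add[of "X i" "X j"]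
    by (simp add: xbar_def quot_ring_def FactRing_def poly_ring_def)
  also have "\<dots> = I" using assms by (rule a_rcos_const)
  finally show ?thesis by (simp add: quot_ring_def FactRing_def)
qed

end

lemma (in cring) signed_closed: "r \<in> carrier R \<Longrightarrow> signed R e r \<in> carrier R"
  by (cases e) (auto simp: signed_def)

lemma (in cring) signed_mult_zero:
  "x \<in> carrier R \<Longrightarrow> y \<in> carrier R \<Longrightarrow> x \<otimes> y = \<zero> \<Longrightarrow> signed R a x \<otimes> signed R b y = \<zero>"
  by (cases a; cases b) (auto simp: signed_def l_minus r_minus)

lemma (in cring) signed_mult_one_differs:
  assumes "one_differs a b c d" "x \<in> carrier R" "y \<in> carrier R"
  shows "signed R d y \<otimes> signed R b x = \<ominus> (signed R c x \<otimes> signed R a y)"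
  using assms
  by (cases a; cases b; cases c; cases d)
    (auto simp: signed_def one_differs_def l_minus r_minus m_comm)


section \<open>Composition of consecutive maps\<close>

lemma (in arrows_determined) component_arrow:
  assumes "cring (quot_ring I)" "xbar I i \<in> carrier (quot_ring I)"
    and "v \<in> V" "(i, w) |\<in>| out v"
  shows "component I s v w = signed (quot_ring I) (s v i w) (xbar I i)"
proof -
  interpret cring "quot_ring I" by fact
  have "{a. (a, w) |\<in>| out v} = {i}" using label_unique assms(3,4) by blast
  then show ?thesis
    unfolding component_def using signed_closed[OF assms(2)] by simp
qed

lemma component_no_arrow:
  assumes "cring (quot_ring I)" "\<And>i. (i, w) |\<notin>| out v"
  shows "component I s v w = \<zero>\<^bsub>quot_ring I\<^esub>"
proof -
  interpret cring "quot_ring I" by fact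
  show ?thesis unfolding component_def using assms(2) by simp
qed

lemma component_closed:
  assumes "ideal I poly_ring"
  shows "component I s v w \<in> carrier (quot_ring I)"
proof -
  interpret cring "quot_ring I" using assms by (rule cring_quot_ring)
  show ?thesis unfolding component_def
    using signed_closed[OF xbar_closed[OF assms]] by (intro finsum_closed) auto
qed

text \<open>
  The terms of the sum correspond to the paths from \<open>u\<close> to \<open>w\<close>, as there is at most one arrow
  between two vertices. Since \<open>path_completes\<close> provides a partner for every nonzero path, and the
  labels of a path determine that partner, the nonzero terms cancel in pairs.
\<close>

lemma (in stage) composition_component_zero:
  assumes ideal: "ideal I poly_ring" and u: "u \<in> completion I V"
    and signs: "\<And>v i v' j w. half_diamond I V v i v' j w \<Longrightarrow> (j, v) |\<in>| out u \<Longrightarrow> (i, v') |\<in>| out u \<Longrightarrow>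
      one_differs (s u j v) (s u i v') (s v i w) (s v' j w)"
  shows "(\<Oplus>\<^bsub>quot_ring I\<^esub>v\<in>V. component I s v w \<otimes>\<^bsub>quot_ring I\<^esub> component I s u v) =
    \<zero>\<^bsub>quot_ring I\<^esub>"
proof -
  interpret upper: stage V "completion I V" I by (rule stage_completion)
  interpret R: cring "quot_ring I" using ideal by (rule cring_quot_ring)
  let ?t = "\<lambda>v. component I s v w \<otimes>\<^bsub>quot_ring I\<^esub> component I s u v"
  define p where "p v v' \<longleftrightarrow> v \<in> V \<and> v' \<in> V \<and> (\<exists>i j. (j, v) |\<in>| out u \<and> (i, w) |\<in>| out v \<and>
    (i, v') |\<in>| out u \<and> (j, w) |\<in>| out v')" for v v'
  note closed = component_closed[OF ideal] and xbar_closed = xbar_closed[OF ideal]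
  note arrow = component_arrow[OF R.is_cring xbar_closed]
    and arrow' = upper.component_arrow[OF R.is_cring xbar_closed]
  show ?thesis
  proof (rule R.finsum_cancelling_pairs[where p = p])
    show "p v' v" if "p v v'" for v v' using that unfolding p_def by blast
    show "v' = v''" if "p v v'" "p v v''" for v v' v''
      using that label_unique upper.label_unique[OF u] upper.target_unique[OF u]
      unfolding p_def by metis
    show "\<exists>v'\<in>V. p v v' \<and> v' \<noteq> v \<and> ?t v' = \<ominus>\<^bsub>quot_ring I\<^esub> ?t v"
      if v: "v \<in> V" and nonzero: "?t v \<noteq> \<zero>\<^bsub>quot_ring I\<^esub>" for v
    proof -
      obtain i where i: "(i, w) |\<in>| out v"
        using nonzero component_no_arrow[OF R.is_cring] closed R.l_null by metis
      obtain j where j: "(j, v) |\<in>| out u"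
        using nonzero component_no_arrow[OF R.is_cring] closed R.r_null by metis
      have t: "?t v = signed (quot_ring I) (s v i w) (xbar I i) \<otimes>\<^bsub>quot_ring I\<^esub>
          signed (quot_ring I) (s u j v) (xbar I j)"
        using arrow[OF v i] arrow'[OF u j] by simp
      have ij: "X i * X j \<notin> I"
        using nonzero t xbar_mult_eq_zero[OF ideal] R.signed_mult_zero xbar_closed by metis
      obtain v' where v': "(i, v') |\<in>| out u" "(j, w) |\<in>| out v'" and "i \<noteq> j"
        using completion_path_completes[OF u j i ij] by blast
      have v'V: "v' \<in> V" using completion_target[OF u v'(1)] .
      have half: "half_diamond I V v i v' j w"
        using half_diamondI[OF v v'V i v'(2) \<open>i \<noteq> j\<close> ij] .
      have "?t v' = \<ominus>\<^bsub>quot_ring I\<^esub> ?t v"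
        using R.signed_mult_one_differs[OF signs[OF half j v'(1)] xbar_closed xbar_closed]
          arrow[OF v'V v'(2)] arrow'[OF u v'(1)] t by simp
      moreover have "p v v'" unfolding p_def using v v'V i j v' by blast
      moreover have "v' \<noteq> v" using half unfolding half_diamond_def by blast
      ultimately show ?thesis using v'V by blast
    qed
  qed (use finite_stage closed in auto)
qed

lemma chain_complex_diagram:
  fixes i :: "'n::finite" and I :: "('n, 'k::field) mpolynomial set"
  assumes ideal: "ideal I poly_ring" and s: "admissible_signing I i s"
  shows "chain_complex (quot_ring I) (diagram_module I i) (diagram_map I i s)"
proof -
  interpret R: cring "quot_ring I" using ideal by (rule cring_quot_ring)
  note closed = component_closed[OF ideal]
  have zero: "(\<Oplus>\<^bsub>quot_ring I\<^esub>v\<in>vertices I i (Suc d).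
      component I s v w \<otimes>\<^bsub>quot_ring I\<^esub> component I s u v) = \<zero>\<^bsub>quot_ring I\<^esub>"
    if u: "u \<in> vertices I i (Suc (Suc d))" for d u w
  proof (rule stage.composition_component_zero[OF stage_vertices ideal])
    show "u \<in> completion I (vertices I i (Suc d))" using u by simp
    show "one_differs (s u j v) (s u k v') (s v k w) (s v' j w)"
      if "half_diamond I (vertices I i (Suc d)) v k v' j w" "(j, v) |\<in>| out u" "(k, v') |\<in>| out u"
      for v k v' j w
      using s that u unfolding admissible_signing_def by simp
  qed
  show ?thesis
    unfolding chain_complex_def
  proof (intro conjI allI ballI)
    show "module (quot_ring I) (diagram_module I i d)" for d
      unfolding diagram_module_def by (rule R.module_free_module)
    show "diagram_map I i s d \<in>
        module_hom (quot_ring I) (diagram_module I i (d + 1)) (diagram_module I i d)" for d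
      unfolding diagram_module_def diagram_map_def
      by (rule R.matrix_in_module_hom[OF finite_vertices closed])
    show "diagram_map I i s d (diagram_map I i s (d + 1) x) = \<zero>\<^bsub>diagram_module I i d\<^esub>"
      if "x \<in> carrier (diagram_module I i (d + 2))" for d x
      using that unfolding diagram_module_def diagram_map_def
      by (intro R.matrix_product_zero[of _ "vertices I i (d + 1 + 1)"])
        (auto simp del: vertices.simps simp: finite_vertices closed zero)
  qed
qed

theorem theorem5:
  fixes q :: "nat \<Rightarrow> ('n::finite, 'k::field) mpolynomial" and m :: nat and i :: 'n
    and I :: "('n, 'k) mpolynomial set"
  assumes "\<forall>l\<in>{1..m}. \<exists>a b. q l = X a * X b"
    and "I = Idl\<^bsub>poly_ring\<^esub> (q ` {1..m})"
    and "\<exists>l\<in>{1..m}. X i dvd q l"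
  shows "(\<exists>s. admissible_signing I i s) \<and>
    (\<forall>s. admissible_signing I i s \<longrightarrow>
       chain_complex (quot_ring I) (diagram_module I i) (diagram_map I i s))"
proof -
  interpret P: cring "poly_ring :: ('n, 'k) mpolynomial ring" by (rule cring_poly_ring)
  have "ideal I poly_ring"
    unfolding assms(2) by (rule P.genideal_ideal) (simp add: poly_ring_def)
  then show ?thesis using admissible_cube_sign chain_complex_diagram by blast
qed

end
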